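(* For all integers $n\ge k\ge 0$, $$\lim_{\lambda\rightarrow 0}G_{\lambda}(n,k)=S_{1}(n,k)\quad\text{and}\quad \lim_{\lambda\rightarrow 1}G_{\lambda}(n,k)=(-1)^{n-k}L(n,k),$$ where the limits are taken over nonzero real $\lambda$.
   Context: For $\lambda\in\mathbb{R}$, $\lambda\neq 0$: $\langle x\rangle_{0,\lambda}=1$, $\langle x\rangle_{n,\lambda}=x(x+\lambda)\cdots(x+(n-1)\lambda)$ for $n\ge 1$. The falling factorial is $(x)_0=1$, $(x)_n=x(x-1)\cdots(x-n+1)$ for $n\ge 1$. The heterogeneous Stirling numbers of the first kind $G_\lambda(n,k)$, $0\le k\le n$, are defined by the polynomial identity $(x)_{n}=\sum_{k=0}^{n}G_{\lambda}(n,k)\langle x\rangle_{k,\lambda}$ for $n\ge 0$. Here $S_1(n,k)$ are the classical (signed) Stirling numbers of the first kind, $(x)_n=\sum_{k=0}^n S_1(n,k)x^k$, and the Lah numbers $L(n,k)$ are defined by $\frac{1}{k!}\left(\frac{t}{1-t}\right)^{k}=\sum_{n=k}^{\infty}L(n,k)\frac{t^{n}}{n!}$ for $k\ge 0$. *)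

theory Defs
  imports
    Complex_Main
    "HOL-Computational_Algebra.Computational_Algebra"
begin

definition falling_fact :: "nat \<Rightarrow> real poly" where
  "falling_fact n = (\<Prod>i<n. [:- of_nat i, 1:])"

definition rising_fact :: "real \<Rightarrow> nat \<Rightarrow> real poly" where
  "rising_fact lam n = (\<Prod>i<n. [:of_nat i * lam, 1:])"

definition stirling1 :: "nat \<Rightarrow> nat \<Rightarrow> real" where
  "stirling1 n k = coeff (falling_fact n) k"

definition lah :: "nat \<Rightarrow> nat \<Rightarrow> real" where
  "lah n k = fact n * fps_nth (fps_const (1 / fact k) * (fps_X / (1 - fps_X)) ^ k) n"

text \<open>The coefficient sequence is required to vanish beyond \<open>n\<close>, which makes it unique as a
  function; \<open>hetero_stirling1_expansion\<close> and \<open>hetero_stirling1_unique\<close> show that the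
  definite description is justified.\<close>

definition hetero_stirling1 :: "real \<Rightarrow> nat \<Rightarrow> nat \<Rightarrow> real" where
  "hetero_stirling1 lam n =
     (THE c. falling_fact n = (\<Sum>k\<le>n. smult (c k) (rising_fact lam k)) \<and> (\<forall>k>n. c k = 0))"

lemma degree_rising_fact: "degree (rising_fact lam n) = n"
  and lead_coeff_rising_fact: "coeff (rising_fact lam n) n = 1"
proof -
  have d: "degree (rising_fact lam n) = n"
    unfolding rising_fact_def by (subst degree_prod_eq_sum_degree) auto
  then show "degree (rising_fact lam n) = n" .
  have "lead_coeff (rising_fact lam n) = 1"
    unfolding rising_fact_def by (simp add: lead_coeff_prod)
  then show "coeff (rising_fact lam n) n = 1" by (simp add: d)
qed

lemma degree_falling_fact: "degree (falling_fact n) = n"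
  unfolding falling_fact_def by (subst degree_prod_eq_sum_degree) auto

lemma rising_fact_expansion_exists:
  assumes "degree p \<le> n"
  shows "\<exists>c. p = (\<Sum>k\<le>n. smult (c k) (rising_fact lam k)) \<and> (\<forall>k>n. c k = 0)"
  using assms
proof (induction n arbitrary: p)
  case 0
  then obtain a where "p = [:a:]" by (auto elim: degree_eq_zeroE)
  then show ?case
    by (intro exI[of _ "\<lambda>k. if k = 0 then a else 0"]) (auto simp: rising_fact_def)
next
  case (Suc n)
  define a where "a = coeff p (Suc n)"
  define q where "q = p - smult a (rising_fact lam (Suc n))"
  have "degree q \<le> n"
  proof (rule degree_le, intro allI impI)
    fix i assume "n < i"
    show "coeff q i = 0"
    proof (cases "i = Suc n")
      case True
      then show ?thesis by (simp add: q_def a_def lead_coeff_rising_fact)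
    next
      case False
      with \<open>n < i\<close> have "Suc n < i" by simp
      then show ?thesis
        using Suc.prems by (simp add: q_def coeff_eq_0 degree_rising_fact)
    qed
  qed
  from Suc.IH[OF this] obtain c where
    c: "q = (\<Sum>k\<le>n. smult (c k) (rising_fact lam k))" "\<forall>k>n. c k = 0" by blast
  have p: "p = q + smult a (rising_fact lam (Suc n))" by (simp add: q_def)
  show ?case
    by (rule exI[of _ "c(Suc n := a)"]) (use c(2) in \<open>auto simp: p c(1) intro!: sum.cong\<close>)
qed

lemma rising_fact_expansion_unique:
  assumes "(\<Sum>k\<le>n. smult (c k) (rising_fact lam k)) = (\<Sum>k\<le>n. smult (d k) (rising_fact lam k))"
    and "k \<le> n"
  shows "c k = d k"
  using assms
proof (induction n)
  case 0
  then show ?case by (simp add: rising_fact_def)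
next
  case (Suc n)
  have z: "coeff (\<Sum>k\<le>n. smult (e k) (rising_fact lam k)) (Suc n) = 0" for e :: "nat \<Rightarrow> real"
    by (simp add: coeff_sum coeff_eq_0 degree_rising_fact)
  have top: "c (Suc n) = d (Suc n)"
    using arg_cong[OF Suc.prems(1), of "\<lambda>p. coeff p (Suc n)"]
    by (simp add: z lead_coeff_rising_fact)
  show ?case
  proof (cases "k = Suc n")
    case False
    then show ?thesis using Suc.IH Suc.prems top by simp
  qed (simp add: top)
qed

lemma hetero_stirling1_ex1:
  "\<exists>!c. falling_fact n = (\<Sum>k\<le>n. smult (c k) (rising_fact lam k)) \<and> (\<forall>k>n. c k = 0)"
proof (rule ex_ex1I)
  show "\<exists>c. falling_fact n = (\<Sum>k\<le>n. smult (c k) (rising_fact lam k)) \<and> (\<forall>k>n. c k = 0)"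
    by (rule rising_fact_expansion_exists) (simp add: degree_falling_fact)
next
  fix c d
  assume c: "falling_fact n = (\<Sum>k\<le>n. smult (c k) (rising_fact lam k)) \<and> (\<forall>k>n. c k = 0)"
    and d: "falling_fact n = (\<Sum>k\<le>n. smult (d k) (rising_fact lam k)) \<and> (\<forall>k>n. d k = 0)"
  show "c = d"
  proof
    fix k
    show "c k = d k"
      using c d rising_fact_expansion_unique[of c lam n d k] by (cases "k \<le> n") auto
  qed
qed

lemma hetero_stirling1_expansion:
  "falling_fact n = (\<Sum>k\<le>n. smult (hetero_stirling1 lam n k) (rising_fact lam k))"
  using theI'[OF hetero_stirling1_ex1[of n lam]] unfolding hetero_stirling1_def by blast

lemma hetero_stirling1_unique:
  assumes "falling_fact n = (\<Sum>k\<le>n. smult (c k) (rising_fact lam k))" and "k \<le> n"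
  shows "hetero_stirling1 lam n k = c k"
  using rising_fact_expansion_unique[of "hetero_stirling1 lam n" lam n c k] assms
    hetero_stirling1_expansion[of n lam] by simp

end

(* The identity (x - n) <x>_k = <x>_{k+1} - (n + k lam) <x>_k yields
   G_lam(n+1,k) = G_lam(n,k-1) - (n + k lam) G_lam(n,k),
   so G_lam(n,k) is continuous (indeed polynomial) in lam on all of R, and both limits are values.
   At lam = 0 the rising factorials are the monomials; at lam = 1 the recurrence is
   that of the Lah numbers up to sign. *)

theory Submission
  imports Defs
begin

lemma rising_fact_Suc: "rising_fact lam (Suc n) = rising_fact lam n * [:of_nat n * lam, 1:]"
  by (simp add: rising_fact_def)

lemma falling_fact_Suc: "falling_fact (Suc n) = falling_fact n * [:- of_nat n, 1:]"
  by (simp add: falling_fact_def)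

lemma rising_fact_0_left: "rising_fact 0 n = monom 1 n"
  by (simp add: rising_fact_def monom_altdef)

lemma hetero_stirling1_eq_0: "n < k \<Longrightarrow> hetero_stirling1 lam n k = 0"
  using theI'[OF hetero_stirling1_ex1[of n lam]] unfolding hetero_stirling1_def by blast

lemma hetero_stirling1_0_0: "hetero_stirling1 lam 0 0 = 1"
  by (rule hetero_stirling1_unique[where c = "\<lambda>_. 1"])
     (simp_all add: falling_fact_def rising_fact_def)

lemma hetero_stirling1_Suc:
  "hetero_stirling1 lam (Suc n) k =
     (case k of 0 \<Rightarrow> 0 | Suc j \<Rightarrow> hetero_stirling1 lam n j)
     - (of_nat n + of_nat k * lam) * hetero_stirling1 lam n k"
proof (cases "k \<le> Suc n")
  case True
  let ?G = "hetero_stirling1 lam n" and ?R = "rising_fact lam"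
  \<comment> \<open>Candidate coefficients: once \<open>falling_fact (Suc n)\<close> is expanded
    with them, uniqueness identifies them.\<close>
  define c where "c k = (case k of 0 \<Rightarrow> 0 | Suc j \<Rightarrow> ?G j) - (of_nat n + of_nat k * lam) * ?G k"
    for k
  have step: "?R k * [:- of_nat n, 1:] = ?R (Suc k) - smult (of_nat n + of_nat k * lam) (?R k)"
    for k
  proof -
    \<comment> \<open>The linear term is exactly the next factor of the rising factorial; only a
      constant remains.\<close>
    have "[:- of_nat n, 1:] = [:of_nat k * lam, 1:] - [:of_nat n + of_nat k * lam:]"
      by simp
    then show ?thesis
      by (simp only: rising_fact_Suc right_diff_distrib) simp
  qed
  have "falling_fact (Suc n) = (\<Sum>k\<le>n. smult (?G k) (?R k)) * [:- of_nat n, 1:]"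
    unfolding falling_fact_Suc by (simp only: hetero_stirling1_expansion[of n lam])
  also have "\<dots> = (\<Sum>k\<le>n. smult (?G k) (?R k * [:- of_nat n, 1:]))"
    by (simp only: sum_distrib_right mult_smult_left)
  also have "\<dots> = (\<Sum>k\<le>n. smult (?G k) (?R (Suc k)))
                - (\<Sum>k\<le>n. smult ((of_nat n + of_nat k * lam) * ?G k) (?R k))"
    by (simp only: step smult_diff_right sum_subtractf smult_smult mult.commute)
  also have "(\<Sum>k\<le>n. smult (?G k) (?R (Suc k)))
      = (\<Sum>k\<le>Suc n. smult (case k of 0 \<Rightarrow> 0 | Suc j \<Rightarrow> ?G j) (?R k))"
    by (simp only: sum.atMost_Suc_shift) simp
  \<comment> \<open>The range can be extended because \<open>?G (Suc n) = 0\<close>.\<close>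
  also have "(\<Sum>k\<le>n. smult ((of_nat n + of_nat k * lam) * ?G k) (?R k))
      = (\<Sum>k\<le>Suc n. smult ((of_nat n + of_nat k * lam) * ?G k) (?R k))"
    by (simp add: hetero_stirling1_eq_0)
  finally have "falling_fact (Suc n) = (\<Sum>k\<le>Suc n. smult (c k) (?R k))"
    by (simp only: c_def smult_diff_left sum_subtractf)
  from hetero_stirling1_unique[OF this True] show ?thesis
    by (simp add: c_def)
next
  case False
  then show ?thesis by (auto simp: hetero_stirling1_eq_0 split: nat.split)
qed

text \<open>By induction along the recurrence, with \<open>k\<close> arbitrary since column
  \<open>k - 1\<close> enters as well.\<close>

lemma isCont_hetero_stirling1: "isCont (\<lambda>lam. hetero_stirling1 lam n k) x"
proof (induction n arbitrary: k)
  case 0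
  show ?case by (cases k) (simp_all add: hetero_stirling1_0_0 hetero_stirling1_eq_0)
next
  case (Suc n)
  then show ?case
    by (cases k) (auto simp: hetero_stirling1_Suc intro!: continuous_intros)
qed

lemma hetero_stirling1_at_0:
  assumes "k \<le> n"
  shows "hetero_stirling1 0 n k = stirling1 n k"
  unfolding stirling1_def
proof (rule hetero_stirling1_unique[OF _ assms])
  \<comment> \<open>As \<open>rising_fact 0 k\<close> is a monomial, this just writes a polynomial
    in its coefficients.\<close>
  show "falling_fact n = (\<Sum>k\<le>n. smult (coeff (falling_fact n) k) (rising_fact 0 k))"
    using poly_as_sum_of_monoms[of "falling_fact n"]
    by (simp add: rising_fact_0_left smult_monom degree_falling_fact)
qed

lemma lah_0_left: "lah 0 k = (if k = 0 then 1 else 0)"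
  by (simp add: lah_def fps_divide_unit)

text \<open>With \<open>u = t/(1-t)\<close> and \<open>F k = u^k/k!\<close>, the relation
  \<open>(1-t) u' = 1 + u\<close> gives \<open>(1-t) F(j+1)' = F j + (j+1) F(j+1)\<close>; compare
  coefficients of \<open>t^n\<close>.\<close>

lemma lah_Suc:
  "lah (Suc n) k = (case k of 0 \<Rightarrow> 0 | Suc j \<Rightarrow> lah n j) + (of_nat n + of_nat k) * lah n k"
proof (cases k)
  case 0
  \<comment> \<open>Here the series is the constant 1, so \<open>lah n 0\<close> vanishes for
    positive \<open>n\<close>, and for \<open>n = 0\<close> the factor \<open>n + k\<close>
    does.\<close>
  then show ?thesis by (cases n) (simp_all add: lah_def)
next
  case (Suc j)
  define u :: "real fps" where "u = fps_X / (1 - fps_X)"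
  define F where "F k = fps_const (1 / fact k) * u ^ k" for k
  have lah: "lah n k = fact n * fps_nth (F k) n" for n k
    by (simp add: lah_def F_def u_def)
  have u: "(1 - fps_X) * u = fps_X"
    by (simp add: u_def fps_divide_unit mult.left_commute inverse_mult_eq_1')
  from arg_cong[OF this, of fps_deriv] have du: "(1 - fps_X) * fps_deriv u = 1 + u"
    by (simp add: algebra_simps)
  have const: "fps_const (1 / fact (Suc j)) * of_nat (Suc j) = (fps_const (1 / fact j) :: real fps)"
    by (simp add: fps_of_nat[symmetric] del: of_nat_Suc)
  have F_mult: "F j * u = of_nat (Suc j) * F (Suc j)"
    by (simp only: F_def const[symmetric] power_Suc mult_ac)
  have F_deriv: "fps_deriv (F (Suc j)) = F j * fps_deriv u"
    unfolding F_def const[symmetric] fps_deriv_mult_const_left fps_deriv_power' diff_Suc_1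
    by (simp only: mult_ac)
  have "(1 - fps_X) * fps_deriv (F (Suc j)) = F j * ((1 - fps_X) * fps_deriv u)"
    by (simp only: F_deriv mult.left_commute)
  also have "\<dots> = F j + of_nat (Suc j) * F (Suc j)"
    by (simp only: du distrib_left mult_1_right F_mult)
  \<comment> \<open>The product with \<open>fps_X\<close> is moved to the right, where its
    coefficient at \<open>n\<close> is \<open>n\<close> times that of
    \<open>F (Suc j)\<close>.\<close>
  finally have "fps_deriv (F (Suc j))
      = fps_X * fps_deriv (F (Suc j)) + F j + fps_const (of_nat (Suc j)) * F (Suc j)"
    by (simp add: algebra_simps fps_of_nat del: of_nat_Suc)
  from arg_cong[OF this, of "\<lambda>f. fps_nth f n"]
  have "of_nat (Suc n) * fps_nth (F (Suc j)) (Suc n)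
      = of_nat n * fps_nth (F (Suc j)) n + fps_nth (F j) n
        + of_nat (Suc j) * fps_nth (F (Suc j)) n"
    by (cases n) (simp_all del: of_nat_Suc)
  \<comment> \<open>The factor \<open>fact n\<close> turns coefficients into Lah numbers, with
    \<open>fact n * (n+1) = fact (n+1)\<close> on the left.\<close>
  from arg_cong[OF this, of "\<lambda>x. fact n * x"] show ?thesis
    by (simp add: Suc lah algebra_simps)
qed

text \<open>The two recurrences differ only in the sign of the last term. The exponent
  \<open>n + k\<close> avoids truncated subtraction, so the induction covers all
  \<open>k\<close>.\<close>

lemma hetero_stirling1_at_1: "hetero_stirling1 1 n k = (-1) ^ (n + k) * lah n k"
proof (induction n arbitrary: k)
  case 0
  show ?case
    by (cases k) (simp_all add: hetero_stirling1_0_0 hetero_stirling1_eq_0 lah_0_left)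
next
  case (Suc n)
  then show ?case
    by (cases k) (simp_all add: hetero_stirling1_Suc lah_Suc algebra_simps)
qed

theorem mainTheorem11:
  fixes n k :: nat
  assumes "k \<le> n"
  shows "((\<lambda>lam. hetero_stirling1 lam n k) \<longlongrightarrow> stirling1 n k) (at 0) \<and>
         ((\<lambda>lam. hetero_stirling1 lam n k) \<longlongrightarrow> (-1) ^ (n - k) * lah n k) (at 1)"
proof -
  \<comment> \<open>The exponents differ by \<open>2 * k\<close>.\<close>
  have "(-1 :: real) ^ (n + k) = (-1) ^ (n - k)"
    using assms by (simp add: minus_one_power_iff)
  then show ?thesis
    using isCont_hetero_stirling1[where n = n and k = k and x = 0]
      isCont_hetero_stirling1[where n = n and k = k and x = 1] assms
    by (simp add: isCont_def hetero_stirling1_at_0 hetero_stirling1_at_1)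
qed

end
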